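(* Let $p\ge 1$ be an integer, let $\beta\in\mathbb{R}$ with $\beta>1-1/p$, and let $\phi:[0,\infty)\to\mathbb{R}$ be a $(p,\beta)$-function with associated data $\{\lambda_n\},\{r_n\},y_0,X_0,\mathcal{E},X(Y)$. If $p$ is odd and greater than $1$, assume in addition that $$\limsup_{Y\to\infty}\ \sup_{y\in[y_0,Y]}|\mathcal{E}(y,X(Y))|=0.$$ Then for every integer $n$ with $1\le n\le p$ the limit $$L_n=\lim_{Y\to\infty}\frac1Y\int_0^Y\phi(y)^n\,dy$$ exists (as a finite real number).
   Context: Let $p\in\mathbb{R}$, $p\ge 1$. A (Lebesgue measurable) function $\phi:[0,\infty)\to\mathbb{R}$ is called a $p$-function if there exist a strictly increasing sequence $\{\lambda_n\}_{n\ge1}$ of positive real numbers tending to infinity, a sequence $\{r_n\}_{n\ge1}$ of complex numbers, and numbers $y_0,X_0>0$ such that $\phi\in L^p([0,y_0])$ and, for all $y\ge y_0$ and $X\ge X_0$, $$\phi(y)=2\Re\Big(\sum_{0<\lambda_n\le X}r_ne^{i\lambda_ny}\Big)+\mathcal{E}(y,X),$$ where $\mathcal{E}(y,X)$ satisfies $$\lim_{Y\to\infty}\frac1Y\int_{y_0}^Y|\mathcal{E}(y,X(Y))|^p\,dy=0$$ for some non-decreasing function $X(Y)$ tending to infinity as $Y\to\infty$. If moreover there is $\beta\in\mathbb{R}$ such that $\sum_{T\le\lambda_n\le T+1}|r_n|\ll T^{-\beta}$ for $T\gg1$ (i.e. there are constants $C,T_0>0$ with $\sum_{T\le\lambda_n\le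 T+1}|r_n|\le CT^{-\beta}$ for all $T\ge T_0$), then $\phi$ is called a $(p,\beta)$-function. The "associated data" of a $(p,\beta)$-function are any fixed choice of $\{\lambda_n\},\{r_n\},y_0,X_0,\mathcal{E},X(Y)$ with these properties. *)

theory Defs
  imports "HOL-Analysis.Analysis"
begin

text \<open>
  A function on \<open>[0, \<infinity>)\<close> is a total function of which only the values on \<open>{0..}\<close> matter; sequences
  are indexed from \<open>0\<close>, i.e. \<open>lam n\<close> and \<open>r n\<close> stand for the \<open>(n+1)\<close>-st terms. The error term is
  real-valued since it is a difference of two real numbers.

  Integrals over nonintegrable functions are \<open>0\<close> by convention, so finiteness of the error
  integrals, which is implicit in the convergence of their averages, is stated explicitly.
  It is only demanded for large \<open>Y\<close>: for small \<open>Y\<close> one may have \<open>XY Y < X0\<close>, where \<open>\<E>\<close> is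
  unconstrained.
\<close>

definition p_function_data ::
  "real \<Rightarrow> (real \<Rightarrow> real) \<Rightarrow> (nat \<Rightarrow> real) \<Rightarrow> (nat \<Rightarrow> complex) \<Rightarrow> real \<Rightarrow> real
    \<Rightarrow> (real \<Rightarrow> real \<Rightarrow> real) \<Rightarrow> (real \<Rightarrow> real) \<Rightarrow> bool" where
  "p_function_data p \<phi> lam r y0 X0 \<E> XY \<longleftrightarrow>
     1 \<le> p \<and>
     \<phi> \<in> borel_measurable (lebesgue_on {0..}) \<and>
     (\<forall>n. 0 < lam n) \<and> strict_mono lam \<and> filterlim lam at_top sequentially \<and>
     0 < y0 \<and> 0 < X0 \<and>
     set_integrable lebesgue {0..y0} (\<lambda>y. \<bar>\<phi> y\<bar> powr p) \<and>
     (\<forall>y\<ge>y0. \<forall>X\<ge>X0.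
        \<phi> y = 2 * Re (\<Sum>n | 0 < lam n \<and> lam n \<le> X. r n * exp (\<i> * of_real (lam n * y))) + \<E> y X) \<and>
     mono_on {y0..} XY \<and> filterlim XY at_top at_top \<and>
     (\<forall>\<^sub>F Y in at_top. set_integrable lebesgue {y0..Y} (\<lambda>y. \<bar>\<E> y (XY Y)\<bar> powr p)) \<and>
     ((\<lambda>Y. 1 / Y * (LINT y:{y0..Y}|lebesgue. \<bar>\<E> y (XY Y)\<bar> powr p)) \<longlongrightarrow> 0) at_top"

definition p_beta_function_data ::
  "real \<Rightarrow> real \<Rightarrow> (real \<Rightarrow> real) \<Rightarrow> (nat \<Rightarrow> real) \<Rightarrow> (nat \<Rightarrow> complex) \<Rightarrow> real \<Rightarrow> real
    \<Rightarrow> (real \<Rightarrow> real \<Rightarrow> real) \<Rightarrow> (real \<Rightarrow> real) \<Rightarrow> bool" where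
  "p_beta_function_data p \<beta> \<phi> lam r y0 X0 \<E> XY \<longleftrightarrow>
     p_function_data p \<phi> lam r y0 X0 \<E> XY \<and>
     (\<exists>C>0. \<exists>T0>0. \<forall>T\<ge>T0.
        (\<Sum>n | T \<le> lam n \<and> lam n \<le> T + 1. cmod (r n)) \<le> C * T powr (- \<beta>))"

end

theory Submission
  imports Defs "HOL-Real_Asymp.Real_Asymp"
begin

text \<open>
  Let \<open>S\<^sub>Y\<close> be the exponential sum truncated at \<open>X(Y)\<close>, with signed frequencies \<open>\<mu>\<close> and coefficients
  \<open>c\<close>. Expanding, the mean of \<open>S\<^sub>Y\<^sup>n\<close> is a sum over \<open>n\<close>-tuples whose terms are dominated, uniformly in
  \<open>Y\<close>, by \<open>\<Prod>\<bar>c\<bar> / (1 + \<bar>\<Sum>\<mu>\<bar>)\<close>. Summing one entry at a time, the window condition with exponent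
  \<open>\<beta> > 1 - 1/p\<close> turns the decay \<open>\<bar>x\<bar>\<^sup>-\<^sup>b\<close> into at least \<open>\<bar>x\<bar>\<close> to the power \<open>-(b - 1/p)\<close>, so starting
  from \<open>b = 1\<close> the total is finite for all \<open>n \<le> p\<close>, and the mean of \<open>S\<^sub>Y\<^sup>n\<close> converges by dominated
  convergence. The error \<open>\<phi>\<^sup>n - S\<^sub>Y\<^sup>n\<close> is at most \<open>\<delta> (1 + S\<^sub>Y\<^sup>q) + K \<bar>\<E>\<bar>\<^sup>p\<close> with \<open>q\<close> the largest even number
  \<open>\<le> p\<close>, and its mean tends to \<open>0\<close> because the mean of \<open>S\<^sub>Y\<^sup>q\<close> is bounded; for odd \<open>p > 1\<close> this needs
  \<open>\<E>\<close> to be uniformly small.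
\<close>

section \<open>Convolution of window masses with power decay\<close>

text \<open>The larger of \<open>u\<close> and \<open>v\<close> is at least \<open>w/2\<close>. A
  factor of exponent \<open>-g\<close> is taken from it, which gives \<open>w powr (-g)\<close>;
  what is left of its exponent is nonpositive, so its base may be replaced by the smaller one, which
  then carries \<open>-h\<close>. The sum on the right covers both orders of \<open>u\<close> and
  \<open>v\<close>.\<close>

lemma powr_product_le:
  fixes u v w a b g h :: real
  assumes "1 \<le> u" "1 \<le> v" "0 < w" "w \<le> u + v"
    and "0 \<le> g" "g \<le> a" "g \<le> b" "a + b = g + h"
  shows "u powr (-a) * v powr (-b) \<le> 2 powr g * w powr (-g) * (u powr (-h) + v powr (-h))"
proof -
  have main: "u powr (-a) * v powr (-b) \<le> 2 powr g * w powr (-g) * v powr (-h)"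
    if "1 \<le> v" "v \<le> u" "w \<le> u + v" "g \<le> a" "a + b = g + h" for u v a b :: real
  proof -
    have "u powr (-a) = u powr (-g) * u powr (g - a)"
      by (simp add: powr_add [symmetric])
    also have "\<dots> \<le> (w/2) powr (-g) * v powr (g - a)"
      using that assms by (intro mult_mono powr_mono2') auto
    also have "(w/2) powr (-g) = 2 powr g * w powr (-g)"
      using assms by (simp add: powr_divide powr_minus field_simps)
    finally have "u powr (-a) * v powr (-b) \<le> 2 powr g * w powr (-g) * v powr (g - a) * v powr (-b)"
      by (intro mult_right_mono) auto
    also have "\<dots> = 2 powr g * w powr (-g) * v powr (-h)"
    proof -
      have "-h = g - a + (-b)" using that by simp
      then show ?thesis by (simp only: powr_add mult.assoc)
    qed
    finally show ?thesis .
  qed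
  show ?thesis
  proof (cases "v \<le> u")
    case True
    have "2 powr g * w powr (-g) * v powr (-h) \<le> 2 powr g * w powr (-g) * (u powr (-h) + v powr (-h))"
      by (intro mult_left_mono) auto
    with main [of v u a b] True assms show ?thesis by linarith
  next
    case False
    have "2 powr g * w powr (-g) * u powr (-h) \<le> 2 powr g * w powr (-g) * (u powr (-h) + v powr (-h))"
      by (intro mult_left_mono) auto
    moreover have "v powr (-b) * u powr (-a) \<le> 2 powr g * w powr (-g) * u powr (-h)"
      using False assms by (intro main) auto
    ultimately show ?thesis by (subst mult.commute [of "u powr (-a)"]) linarith
  qed
qed

lemma sum_int_powr_bounded:
  fixes h :: real
  assumes "1 < h"
  shows "\<exists>C\<ge>0. \<forall>M::int set. finite M \<longrightarrow> (\<Sum>m\<in>M. (1 + \<bar>of_int m\<bar>) powr (-h)) \<le> C"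
proof -
  define f where "f n = (1 + real n) powr (-h)" for n
  have "summable (\<lambda>n. real (Suc n) powr (-h))"
    using assms summable_real_powr_iff[of "-h"] by (subst summable_Suc_iff) simp
  then have sm: "summable f" unfolding f_def by (simp add: add.commute)
  \<comment> \<open>On the nonnegative and on the negative integers separately, \<open>|m|\<close>
    is injective, so each half is part of the series over the naturals.\<close>
  have part: "(\<Sum>m\<in>N. (1 + \<bar>of_int m\<bar>) powr (-h)) \<le> suminf f"
    if "finite N" "inj_on (\<lambda>m. nat \<bar>m\<bar>) N" for N :: "int set"
  proof -
    have "(\<Sum>m\<in>N. (1 + \<bar>of_int m\<bar>) powr (-h)) = (\<Sum>m\<in>N. f (nat \<bar>m\<bar>))"
      unfolding f_def by (intro sum.cong) (auto simp: of_nat_nat)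
    also have "\<dots> = sum f ((\<lambda>m. nat \<bar>m\<bar>) ` N)"
      using that by (simp add: sum.reindex)
    also have "\<dots> \<le> suminf f"
      using that by (intro sum_le_suminf sm) (auto simp: f_def)
    finally show ?thesis .
  qed
  have nn: "0 \<le> suminf f" using part [of "{}"] by simp
  have "(\<Sum>m\<in>M. (1 + \<bar>of_int m\<bar>) powr (-h)) \<le> 2 * suminf f" if "finite M" for M :: "int set"
  proof -
    have "M = {m\<in>M. 0 \<le> m} \<union> {m\<in>M. m < 0}" by auto
    then have "(\<Sum>m\<in>M. (1 + \<bar>of_int m\<bar>) powr (-h)) =
        (\<Sum>m\<in>{m\<in>M. 0 \<le> m} \<union> {m\<in>M. m < 0}. (1 + \<bar>of_int m\<bar>) powr (-h))" by simp
    also have "\<dots> = (\<Sum>m\<in>{m\<in>M. 0 \<le> m}. (1 + \<bar>of_int m\<bar>) powr (-h)) +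
        (\<Sum>m\<in>{m\<in>M. m < 0}. (1 + \<bar>of_int m\<bar>) powr (-h))"
      using that by (intro sum.union_disjoint) auto
    also have "\<dots> \<le> suminf f + suminf f"
      using that by (intro add_mono part) (auto simp: inj_on_def)
    finally show ?thesis by simp
  qed
  with nn show ?thesis by (intro exI [of _ "2 * suminf f"]) auto
qed

text \<open>Replacing \<open>x\<close> by its floor changes \<open>1 + |x + m|\<close> by a factor
  of at most 2, and an integer shift only permutes the summation index. So the bound is uniform in
  \<open>x\<close>.\<close>

lemma sum_shifted_int_powr_bounded:
  fixes h :: real
  assumes "1 < h"
  shows "\<exists>C\<ge>0. \<forall>(x::real) (M::int set). finite M \<longrightarrow> (\<Sum>m\<in>M. (1 + \<bar>x + of_int m\<bar>) powr (-h)) \<le> C"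
proof -
  obtain C where C: "0 \<le> C"
    "\<And>M::int set. finite M \<Longrightarrow> (\<Sum>m\<in>M. (1 + \<bar>of_int m\<bar>) powr (-h)) \<le> C"
    using sum_int_powr_bounded [OF assms] by blast
  have "(\<Sum>m\<in>M. (1 + \<bar>x + of_int m\<bar>) powr (-h)) \<le> 2 powr h * C" if "finite M" for x and M :: "int set"
  proof -
    have "(1 + \<bar>x + of_int m\<bar>) powr (-h) \<le> 2 powr h * (1 + \<bar>of_int (\<lfloor>x\<rfloor> + m)\<bar>) powr (-h)" for m :: int
    proof -
      have "(1 + \<bar>x + of_int m\<bar>) powr (-h) \<le> ((1 + \<bar>of_int (\<lfloor>x\<rfloor> + m)\<bar>) / 2) powr (-h)"
        using assms by (intro powr_mono2') (auto simp: abs_if; linarith)+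
      also have "\<dots> = 2 powr h * (1 + \<bar>of_int (\<lfloor>x\<rfloor> + m)\<bar>) powr (-h)"
        by (simp add: powr_divide powr_minus field_simps)
      finally show ?thesis .
    qed
    then have "(\<Sum>m\<in>M. (1 + \<bar>x + of_int m\<bar>) powr (-h)) \<le>
        (\<Sum>m\<in>M. 2 powr h * (1 + \<bar>of_int (\<lfloor>x\<rfloor> + m)\<bar>) powr (-h))"
      by (intro sum_mono)
    also have "\<dots> = 2 powr h * (\<Sum>m\<in>(+) \<lfloor>x\<rfloor> ` M. (1 + \<bar>of_int m\<bar>) powr (-h))"
      by (subst sum.reindex) (auto simp: sum_distrib_left)
    also have "\<dots> \<le> 2 powr h * C"
      using that by (intro mult_left_mono C) auto
    finally show ?thesis .
  qed
  with C(1) show ?thesis by (intro exI [of _ "2 powr h * C"]) auto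
qed

text \<open>The abstract index type lets each frequency occur with both signs. Quantifying over
  finite \<open>J\<close> avoids any prior summability, and \<open>1 + |m|\<close> spares an
  exception for the window at 0.\<close>

definition window_decay :: "('i \<Rightarrow> real) \<Rightarrow> ('i \<Rightarrow> real) \<Rightarrow> real \<Rightarrow> bool" where
  "window_decay w \<mu> \<beta> \<longleftrightarrow> (\<forall>j. 0 \<le> w j) \<and>
     (\<exists>C\<ge>0. \<forall>(m::int) J. finite J \<longrightarrow> (\<forall>j\<in>J. \<lfloor>\<mu> j\<rfloor> = m) \<longrightarrow> sum w J \<le> C * (1 + \<bar>of_int m\<bar>) powr (-\<beta>))"

text \<open>Group the indices by \<open>m\<close>, the floor of \<mu>, and replace \<mu> by
  \<open>m\<close> at the cost of a factor \<open>2 powr b\<close>. With 1+|m|, 1+|x+m| and 1+|x| as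
  \<open>u\<close>, \<open>v\<close>, \<open>w\<close>, the product inequality extracts the decay in
  \<open>x\<close>. It leaves exponent \<open>h > 1\<close>, whose sums over \<open>m\<close> are
  bounded uniformly in \<open>x\<close>.\<close>

lemma window_decay_convolution:
  assumes wd: "window_decay w \<mu> \<beta>"
    and "0 \<le> g" "g \<le> \<beta>" "g \<le> b" "g + 1 < \<beta> + b"
  shows "\<exists>C\<ge>0. \<forall>x J. finite J \<longrightarrow> (\<Sum>j\<in>J. w j * (1 + \<bar>x + \<mu> j\<bar>) powr (-b)) \<le> C * (1 + \<bar>x\<bar>) powr (-g)"
proof -
  define h where "h = \<beta> + b - g"
  have h: "1 < h" using assms by (simp add: h_def)
  obtain D where D: "0 \<le> D" "\<And>m J. finite J \<Longrightarrow> \<forall>j\<in>J. \<lfloor>\<mu> j\<rfloor> = m \<Longrightarrow> sum w J \<le> D * (1 + \<bar>of_int m\<bar>) powr (-\<beta>)"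
    and w: "\<And>j. 0 \<le> w j"
    using wd unfolding window_decay_def by blast
  obtain K where K: "0 \<le> K" "\<And>(x::real) (M::int set). finite M \<Longrightarrow> (\<Sum>m\<in>M. (1 + \<bar>x + of_int m\<bar>) powr (-h)) \<le> K"
    using sum_shifted_int_powr_bounded [OF h] by blast
  define C where "C = 2 powr b * D * 2 powr g * (2 * K)"
  have "(\<Sum>j\<in>J. w j * (1 + \<bar>x + \<mu> j\<bar>) powr (-b)) \<le> C * (1 + \<bar>x\<bar>) powr (-g)" if "finite J" for x J
  proof -
    define M where "M = (\<lambda>j. \<lfloor>\<mu> j\<rfloor>) ` J"
    have M: "finite M" using that by (simp add: M_def)
    have "(\<Sum>j\<in>J. w j * (1 + \<bar>x + \<mu> j\<bar>) powr (-b)) =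
        (\<Sum>m\<in>M. \<Sum>j | j \<in> J \<and> \<lfloor>\<mu> j\<rfloor> = m. w j * (1 + \<bar>x + \<mu> j\<bar>) powr (-b))"
      unfolding M_def by (rule sum.image_gen [OF that])
    also have "\<dots> \<le> (\<Sum>m\<in>M. 2 powr b * D * ((1 + \<bar>of_int m\<bar>) powr (-\<beta>) * (1 + \<bar>x + of_int m\<bar>) powr (-b)))"
    proof (intro sum_mono)
      fix m :: int
      have "(\<Sum>j | j \<in> J \<and> \<lfloor>\<mu> j\<rfloor> = m. w j * (1 + \<bar>x + \<mu> j\<bar>) powr (-b))
          \<le> (\<Sum>j | j \<in> J \<and> \<lfloor>\<mu> j\<rfloor> = m. w j * (2 powr b * (1 + \<bar>x + of_int m\<bar>) powr (-b)))"
      proof (intro sum_mono mult_left_mono w)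
        fix j assume "j \<in> {j. j \<in> J \<and> \<lfloor>\<mu> j\<rfloor> = m}"
        then have "of_int m \<le> \<mu> j" "\<mu> j < of_int m + 1" by (auto; linarith)+
        then have "(1 + \<bar>x + of_int m\<bar>) / 2 \<le> 1 + \<bar>x + \<mu> j\<bar>" by (auto simp: abs_if)
        then have "(1 + \<bar>x + \<mu> j\<bar>) powr (-b) \<le> ((1 + \<bar>x + of_int m\<bar>) / 2) powr (-b)"
          using assms by (intro powr_mono2') auto
        also have "\<dots> = 2 powr b * (1 + \<bar>x + of_int m\<bar>) powr (-b)"
          by (simp add: powr_divide powr_minus field_simps)
        finally show "(1 + \<bar>x + \<mu> j\<bar>) powr (-b) \<le> 2 powr b * (1 + \<bar>x + of_int m\<bar>) powr (-b)" .
      qed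
      also have "\<dots> = sum w {j. j \<in> J \<and> \<lfloor>\<mu> j\<rfloor> = m} * (2 powr b * (1 + \<bar>x + of_int m\<bar>) powr (-b))"
        by (simp add: sum_distrib_right)
      also have "\<dots> \<le> (D * (1 + \<bar>of_int m\<bar>) powr (-\<beta>)) * (2 powr b * (1 + \<bar>x + of_int m\<bar>) powr (-b))"
        using that by (intro mult_right_mono D) auto
      finally show "(\<Sum>j | j \<in> J \<and> \<lfloor>\<mu> j\<rfloor> = m. w j * (1 + \<bar>x + \<mu> j\<bar>) powr (-b))
          \<le> 2 powr b * D * ((1 + \<bar>of_int m\<bar>) powr (-\<beta>) * (1 + \<bar>x + of_int m\<bar>) powr (-b))"
        by (simp add: mult_ac)
    qed
    also have "\<dots> \<le> (\<Sum>m\<in>M. 2 powr b * D * (2 powr g * (1 + \<bar>x\<bar>) powr (-g) *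
        ((1 + \<bar>of_int m\<bar>) powr (-h) + (1 + \<bar>x + of_int m\<bar>) powr (-h))))"
      using assms D(1) by (intro sum_mono mult_left_mono powr_product_le) (auto simp: h_def)
    also have "\<dots> = 2 powr b * D * 2 powr g * (1 + \<bar>x\<bar>) powr (-g) *
        ((\<Sum>m\<in>M. (1 + \<bar>0 + of_int m\<bar>) powr (-h)) + (\<Sum>m\<in>M. (1 + \<bar>x + of_int m\<bar>) powr (-h)))"
      by (simp add: sum_distrib_left sum.distrib distrib_left mult_ac)
    also have "\<dots> \<le> 2 powr b * D * 2 powr g * (1 + \<bar>x\<bar>) powr (-g) * (K + K)"
      using M D(1) by (intro mult_left_mono add_mono K) auto
    finally show ?thesis by (simp add: C_def mult_ac)
  qed
  moreover have "0 \<le> C" using D(1) K(1) by (simp add: C_def)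
  ultimately show ?thesis by blast
qed

section \<open>Absolutely convergent sums over tuples of frequencies\<close>

lemma sum_tuples_Suc:
  assumes "finite J"
  shows "(\<Sum>t | set t \<subseteq> J \<and> length t = Suc n. F t) = (\<Sum>j\<in>J. \<Sum>t | set t \<subseteq> J \<and> length t = n. F (j # t))"
proof -
  have "(\<Sum>t | set t \<subseteq> J \<and> length t = Suc n. F t) =
      (\<Sum>(t,j)\<in>{t. set t \<subseteq> J \<and> length t = n} \<times> J. F (j # t))"
    unfolding lists_length_Suc_eq by (subst sum.reindex) (auto simp: inj_on_def case_prod_unfold)
  also have "\<dots> = (\<Sum>t | set t \<subseteq> J \<and> length t = n. \<Sum>j\<in>J. F (j # t))"
    by (rule sum.cartesian_product [symmetric])
  also have "\<dots> = (\<Sum>j\<in>J. \<Sum>t | set t \<subseteq> J \<and> length t = n. F (j # t))"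
    by (rule sum.swap)
  finally show ?thesis .
qed

lemma power_sum_eq_sum_tuples:
  fixes f :: "'i \<Rightarrow> 'a::comm_semiring_1"
  assumes "finite J"
  shows "(\<Sum>j\<in>J. f j) ^ n = (\<Sum>t | set t \<subseteq> J \<and> length t = n. prod_list (map f t))"
proof (induction n)
  case 0
  have "{t. set t \<subseteq> J \<and> length t = 0} = {[]}" by auto
  then show ?case by simp
next
  case (Suc n)
  then show ?case
    by (simp add: sum_tuples_Suc [OF assms] sum_distrib_left [symmetric] sum_distrib_right [symmetric] del: length_Suc_conv)
qed

text \<open>The shift \<open>x\<close> is free so that induction works: splitting off a first entry
  \<open>j\<close> turns \<open>x\<close> into \<open>x + \<mu> j\<close>, and the induction
  hypothesis leaves a single convolution sum over \<open>j\<close>. Each entry costs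
  \<open>1/p\<close> of the exponent. The condition \<open>g + 1 < \<beta> + b\<close> of the
  convolution bound is then exactly \<open>\<beta> > 1 - 1/p\<close>, and \<open>g\<close> stays
  nonnegative up to \<open>n = p\<close>.\<close>

lemma tuple_sum_decay:
  fixes p :: nat
  assumes wd: "window_decay w \<mu> \<beta>" and "1 \<le> p" "\<beta> > 1 - 1 / real p" "n \<le> p"
  shows "\<exists>C\<ge>0. \<forall>x J. finite J \<longrightarrow>
    (\<Sum>t | set t \<subseteq> J \<and> length t = n. prod_list (map w t) * (1 + \<bar>x + sum_list (map \<mu> t)\<bar>) powr (-1))
      \<le> C * (1 + \<bar>x\<bar>) powr (- (1 - real n / real p))"
  using \<open>n \<le> p\<close>
proof (induction n)
  case 0
  have "{t. set t \<subseteq> J \<and> length t = 0} = {[]}" for J :: "'a set" by auto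
  then show ?case by (intro exI [of _ 1]) auto
next
  case (Suc n)
  define b where "b = 1 - real n / real p"
  define g where "g = 1 - real (Suc n) / real p"
  have w: "0 \<le> w j" for j using wd by (simp add: window_decay_def)
  obtain C where C: "0 \<le> C" "\<And>x J. finite J \<Longrightarrow>
    (\<Sum>t | set t \<subseteq> J \<and> length t = n. prod_list (map w t) * (1 + \<bar>x + sum_list (map \<mu> t)\<bar>) powr (-1))
      \<le> C * (1 + \<bar>x\<bar>) powr (- b)"
    using Suc b_def by auto
  have gb: "g = b - 1 / real p" by (simp add: b_def g_def add_divide_distrib)
  have "real (Suc n) / real p \<le> 1" using Suc.prems assms by simp
  then have "0 \<le> g" by (simp add: g_def)
  moreover have "g \<le> \<beta>"
  proof -
    have "1 / real p \<le> real (Suc n) / real p" by (intro divide_right_mono) auto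
    then show ?thesis using assms(3) by (simp add: g_def)
  qed
  moreover have "g \<le> b" "g + 1 < \<beta> + b" using assms(3) by (simp_all add: gb)
  ultimately obtain D where D: "0 \<le> D"
    "\<And>x J. finite J \<Longrightarrow> (\<Sum>j\<in>J. w j * (1 + \<bar>x + \<mu> j\<bar>) powr (-b)) \<le> D * (1 + \<bar>x\<bar>) powr (-g)"
    using window_decay_convolution [OF wd, of g b] by blast
  have "(\<Sum>t | set t \<subseteq> J \<and> length t = Suc n. prod_list (map w t) * (1 + \<bar>x + sum_list (map \<mu> t)\<bar>) powr (-1))
      \<le> C * D * (1 + \<bar>x\<bar>) powr (- g)" if J: "finite J" for x J
  proof -
    have "(\<Sum>t | set t \<subseteq> J \<and> length t = Suc n. prod_list (map w t) * (1 + \<bar>x + sum_list (map \<mu> t)\<bar>) powr (-1))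
      = (\<Sum>j\<in>J. w j * (\<Sum>t | set t \<subseteq> J \<and> length t = n.
          prod_list (map w t) * (1 + \<bar>(x + \<mu> j) + sum_list (map \<mu> t)\<bar>) powr (-1)))"
      by (subst sum_tuples_Suc [OF J]) (simp add: sum_distrib_left mult.assoc add.assoc)
    also have "\<dots> \<le> (\<Sum>j\<in>J. w j * (C * (1 + \<bar>x + \<mu> j\<bar>) powr (- b)))"
      by (intro sum_mono mult_left_mono C J w)
    also have "\<dots> = C * (\<Sum>j\<in>J. w j * (1 + \<bar>x + \<mu> j\<bar>) powr (- b))"
      by (simp add: sum_distrib_left mult_ac)
    also have "\<dots> \<le> C * (D * (1 + \<bar>x\<bar>) powr (- g))"
      by (intro mult_left_mono D J C)
    finally show ?thesis by (simp add: mult_ac)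
  qed
  moreover have "0 \<le> C * D" using C D by simp
  ultimately show ?case unfolding g_def by blast
qed

text \<open>A finite set of tuples involves only finitely many entries, so the preceding bound at
  \<open>x = 0\<close> controls every finite partial sum. Integrability for counting measure is the
  form that dominated convergence takes later.\<close>

lemma tuple_sum_integrable:
  fixes p :: nat
  assumes wd: "window_decay w \<mu> \<beta>" and "1 \<le> p" "\<beta> > 1 - 1 / real p" "n \<le> p"
  shows "integrable (count_space {t. length t = n})
    (\<lambda>t. prod_list (map w t) * (1 + \<bar>sum_list (map \<mu> t)\<bar>) powr (-1))"
proof -
  define f where "f t = prod_list (map w t) * (1 + \<bar>sum_list (map \<mu> t)\<bar>) powr (-1)" for t
  have w: "0 \<le> w j" for j using wd by (simp add: window_decay_def)
  have f: "0 \<le> f t" for t unfolding f_def by (intro mult_nonneg_nonneg prod_list_nonneg) (auto simp: w)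
  obtain C where C: "\<And>x J. finite J \<Longrightarrow>
    (\<Sum>t | set t \<subseteq> J \<and> length t = n. prod_list (map w t) * (1 + \<bar>x + sum_list (map \<mu> t)\<bar>) powr (-1))
      \<le> C * (1 + \<bar>x\<bar>) powr (- (1 - real n / real p))"
    using tuple_sum_decay [OF assms] by blast
  have "sum f F \<le> C" if F: "finite F" "F \<subseteq> {t. length t = n}" for F
  proof -
    define J where "J = \<Union> (set ` F)"
    have J: "finite J" using F by (simp add: J_def)
    have "sum f F \<le> sum f {t. set t \<subseteq> J \<and> length t = n}"
      using F J by (intro sum_mono2 f finite_lists_length_eq) (auto simp: J_def)
    also have "\<dots> \<le> C" using C [of J 0] J by (simp add: f_def)
    finally show ?thesis .
  qed
  then have "f summable_on {t. length t = n}"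
    by (intro nonneg_bdd_above_summable_on bdd_aboveI [of _ C]) (auto simp: f)
  then have "Infinite_Sum.abs_summable_on f {t. length t = n}" using f by simp
  then have "Infinite_Set_Sum.abs_summable_on f {t. length t = n}" by (rule abs_summable_equivalent [THEN iffD1])
  then show ?thesis by (simp add: Infinite_Set_Sum.abs_summable_on_def f_def [abs_def])
qed

section \<open>Means of a single exponential\<close>

lemma set_integral_cexp:
  fixes a b x :: real
  assumes "a \<le> b" "x \<noteq> 0"
  shows "(LINT y:{a..b}|lebesgue. exp (\<i> * of_real (x * y))) =
    (exp (\<i> * of_real (x * b)) - exp (\<i> * of_real (x * a))) / (\<i> * of_real x)"
proof -
  have "((\<lambda>y. exp (\<i> * of_real (x * y))) has_integral
      exp (\<i> * of_real (x * b)) / (\<i> * of_real x) - exp (\<i> * of_real (x * a)) / (\<i> * of_real x)) {a..b}"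
    using assms by (intro fundamental_theorem_of_calculus)
      (auto intro!: derivative_eq_intros has_vector_derivative_real_field simp: algebra_simps)
  moreover have "set_integrable lebesgue {a..b} (\<lambda>y. exp (\<i> * of_real (x * y)))"
    by (intro absolutely_integrable_continuous_real continuous_intros)
  ultimately show ?thesis
    by (simp add: set_lebesgue_integral_eq_integral integral_unique diff_divide_distrib)
qed

text \<open>The integral starts at \<open>y0\<close> but is divided by \<open>Y\<close>, as in the
  condition on the error term; the limit is the same as with \<open>Y - y0\<close>.\<close>

definition exp_mean :: "real \<Rightarrow> real \<Rightarrow> real \<Rightarrow> complex" where
  "exp_mean y0 x Y = of_real (1 / Y) * (LINT y:{y0..Y}|lebesgue. exp (\<i> * of_real (x * y)))"

lemma exp_mean_zero: "0 < y0 \<Longrightarrow> y0 \<le> Y \<Longrightarrow> exp_mean y0 0 Y = of_real ((Y - y0) / Y)"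
  by (simp add: exp_mean_def set_lebesgue_integral_def scaleR_conv_of_real)

lemma norm_exp_mean_le:
  assumes "0 < y0" "y0 \<le> Y" "x \<noteq> 0"
  shows "norm (exp_mean y0 x Y) \<le> 2 / (Y * \<bar>x\<bar>)"
proof -
  have "norm (exp (\<i> * of_real (x * Y)) - exp (\<i> * of_real (x * y0))) \<le> 1 + 1"
    by (rule norm_triangle_le_diff) simp
  then show ?thesis using assms(1,3)
    unfolding exp_mean_def set_integral_cexp [OF assms(2,3)]
    using assms(2) by (simp add: norm_mult norm_divide divide_simps)
qed

text \<open>This is the majorant independent of \<open>Y\<close>. The trivial bound 1 serves for |x|
  at most 1 and the bound 2/|x| beyond; the constant 4 covers both.\<close>

lemma norm_exp_mean_le_decay:
  assumes "0 < y0" "y0 \<le> Y" "1 \<le> Y"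
  shows "norm (exp_mean y0 x Y) \<le> 4 * (1 + \<bar>x\<bar>) powr (-1)"
proof (cases "\<bar>x\<bar> \<le> 1")
  case True
  have int: "integrable lebesgue (\<lambda>y. indicator {y0..Y} y *\<^sub>R exp (\<i> * of_real (x * y)))"
    unfolding set_integrable_def [symmetric]
    by (intro absolutely_integrable_continuous_real continuous_intros)
  have "norm (LINT y:{y0..Y}|lebesgue. exp (\<i> * of_real (x * y))) \<le> (LINT y:{y0..Y}|lebesgue. 1)"
    unfolding set_lebesgue_integral_def
    using absolutely_integrable_continuous_real [of y0 Y "\<lambda>_. 1 :: real"]
    by (intro Bochner_Integration.integral_norm_bound_integral [OF int]) (auto simp: set_integrable_def)
  also have "\<dots> = Y - y0" using assms by (simp add: set_lebesgue_integral_def)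
  finally have "norm (exp_mean y0 x Y) \<le> (Y - y0) / Y"
    using assms by (simp add: exp_mean_def norm_mult norm_divide divide_simps)
  also have "\<dots> \<le> 1" using assms by simp
  also have "\<dots> \<le> 4 * (1 + \<bar>x\<bar>) powr (-1)"
    using True by (auto simp: powr_minus divide_simps abs_if)
  finally show ?thesis .
next
  case False
  then have "norm (exp_mean y0 x Y) \<le> 2 / (Y * \<bar>x\<bar>)"
    using assms by (intro norm_exp_mean_le) auto
  also have "\<dots> \<le> 2 / (1 * \<bar>x\<bar>)"
    using assms False by (intro divide_left_mono mult_right_mono) auto
  also have "\<dots> \<le> 4 * (1 + \<bar>x\<bar>) powr (-1)"
    using False by (simp add: powr_minus divide_simps)
  finally show ?thesis .
qed

lemma exp_mean_tendsto:
  assumes "0 < y0"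
  shows "(exp_mean y0 x \<longlongrightarrow> (if x = 0 then 1 else 0)) at_top"
proof (cases "x = 0")
  case True
  have "((\<lambda>Y. (Y - y0) / Y) \<longlongrightarrow> 1) at_top" by real_asymp
  then have "((\<lambda>Y. of_real ((Y - y0) / Y)) \<longlongrightarrow> (of_real 1 :: complex)) at_top"
    by (rule tendsto_of_real)
  then have "(exp_mean y0 0 \<longlongrightarrow> of_real 1) at_top"
    by (rule Lim_transform_eventually)
      (use assms in \<open>auto intro!: eventually_mono [OF eventually_ge_at_top [of y0]] simp: exp_mean_zero\<close>)
  then show ?thesis using True by simp
next
  case False
  have "((\<lambda>Y. 2 / (Y * \<bar>x\<bar>)) \<longlongrightarrow> 0) at_top"
    using False by real_asymp
  then have "(exp_mean y0 x \<longlongrightarrow> 0) at_top"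
    by (rule Lim_null_comparison [rotated])
      (use assms False in \<open>auto intro!: eventually_mono [OF eventually_ge_at_top [of y0]] norm_exp_mean_le\<close>)
  then show ?thesis using False by simp
qed

section \<open>Means of powers of exponential sums\<close>

lemma prod_list_mult_cexp:
  "prod_list (map (\<lambda>j. c j * exp (\<i> * of_real (\<mu> j * y))) t) =
    prod_list (map c t) * exp (\<i> * of_real (sum_list (map \<mu> t) * y))"
  by (induction t) (simp_all add: exp_add [symmetric] algebra_simps mult_exp_exp)

lemma mean_power_exp_sum:
  assumes "finite J"
  shows "of_real (1 / Y) * (LINT y:{y0..Y}|lebesgue. (\<Sum>j\<in>J. c j * exp (\<i> * of_real (\<mu> j * y))) ^ n) =
    (\<Sum>t | set t \<subseteq> J \<and> length t = n. prod_list (map c t) * exp_mean y0 (sum_list (map \<mu> t)) Y)"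
proof -
  have int: "integrable lebesgue (\<lambda>y. indicator {y0..Y} y *\<^sub>R (a * exp (\<i> * of_real (x * y))))" for a x
    unfolding set_integrable_def [symmetric]
    by (intro absolutely_integrable_continuous_real continuous_intros)
  have "(LINT y:{y0..Y}|lebesgue. (\<Sum>j\<in>J. c j * exp (\<i> * of_real (\<mu> j * y))) ^ n) =
      (LINT y:{y0..Y}|lebesgue. (\<Sum>t | set t \<subseteq> J \<and> length t = n.
         prod_list (map c t) * exp (\<i> * of_real (sum_list (map \<mu> t) * y))))"
    by (simp only: power_sum_eq_sum_tuples [OF assms] prod_list_mult_cexp)
  also have "\<dots> = (\<Sum>t | set t \<subseteq> J \<and> length t = n.
      LINT y:{y0..Y}|lebesgue. prod_list (map c t) * exp (\<i> * of_real (sum_list (map \<mu> t) * y)))"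
    unfolding set_lebesgue_integral_def scaleR_sum_right
    by (rule Bochner_Integration.integral_sum) (rule int)
  finally show ?thesis
    by (simp add: exp_mean_def sum_distrib_left mult_ac)
qed

text \<open>The finite index set moves with \<open>Y\<close>. Extending the summand by 0 gives a sum
  over one fixed set of tuples, to which dominated convergence applies.\<close>

lemma mean_power_exp_sum_convergent:
  fixes c :: "'i \<Rightarrow> complex" and J :: "real \<Rightarrow> 'i set"
  assumes int: "integrable (count_space {t. length t = n})
      (\<lambda>t. prod_list (map (\<lambda>j. cmod (c j)) t) * (1 + \<bar>sum_list (map \<mu> t)\<bar>) powr (-1))"
    and J: "\<And>Y. finite (J Y)" "\<And>j. \<forall>\<^sub>F Y in at_top. j \<in> J Y" and y0: "0 < y0"
  shows "\<exists>L. ((\<lambda>Y. of_real (1 / Y) *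
    (LINT y:{y0..Y}|lebesgue. (\<Sum>j\<in>J Y. c j * exp (\<i> * of_real (\<mu> j * y))) ^ n)) \<longlongrightarrow> L) at_top"
proof -
  define A where "A = {t :: 'i list. length t = n}"
  define h where "h Y t = (if set t \<subseteq> J Y then prod_list (map c t) * exp_mean y0 (sum_list (map \<mu> t)) Y else 0)" for Y t
  define w where "w t = 4 * (prod_list (map (\<lambda>j. cmod (c j)) t) * (1 + \<bar>sum_list (map \<mu> t)\<bar>) powr (-1))" for t
  \<comment> \<open>Only tuples whose frequencies sum to zero survive in the limit.\<close>
  define l where "l t = prod_list (map c t) * (if sum_list (map \<mu> t) = 0 then 1 else 0)" for t
  have nprod: "cmod (prod_list (map c t)) = prod_list (map (\<lambda>j. cmod (c j)) t)" for t
    by (induction t) (simp_all add: norm_mult)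
  \<comment> \<open>A tuple has finitely many entries, each of which eventually lies in
    \<open>J Y\<close>.\<close>
  have sub: "\<forall>\<^sub>F Y in at_top. set t \<subseteq> J Y" for t
    using J(2) by (auto simp: subset_eq eventually_ball_finite_distrib)
  have lim: "((\<lambda>Y. h Y t) \<longlongrightarrow> l t) at_top" for t
  proof (rule Lim_transform_eventually)
    show "((\<lambda>Y. prod_list (map c t) * exp_mean y0 (sum_list (map \<mu> t)) Y) \<longlongrightarrow> l t) at_top"
      unfolding l_def by (intro tendsto_intros exp_mean_tendsto y0)
    show "\<forall>\<^sub>F Y in at_top. prod_list (map c t) * exp_mean y0 (sum_list (map \<mu> t)) Y = h Y t"
      using sub [of t] by eventually_elim (simp add: h_def)
  qed
  have bound: "\<forall>\<^sub>F Y in at_top. \<forall>t. norm (h Y t) \<le> w t"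
    using eventually_ge_at_top [of "max 1 y0"]
  proof eventually_elim
    case (elim Y)
    have "norm (h Y t) \<le> w t" for t
    proof (cases "set t \<subseteq> J Y")
      case True
      have "norm (h Y t) = prod_list (map (\<lambda>j. cmod (c j)) t) * norm (exp_mean y0 (sum_list (map \<mu> t)) Y)"
        using True by (simp add: h_def norm_mult nprod)
      also have "\<dots> \<le> prod_list (map (\<lambda>j. cmod (c j)) t) * (4 * (1 + \<bar>sum_list (map \<mu> t)\<bar>) powr (-1))"
        using elim y0 by (intro mult_left_mono norm_exp_mean_le_decay prod_list_nonneg) auto
      finally show ?thesis by (simp add: w_def mult_ac)
    next
      case False
      moreover have "0 \<le> w t"
        unfolding w_def by (intro mult_nonneg_nonneg prod_list_nonneg) auto
      ultimately show ?thesis by (simp add: h_def)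
    qed
    then show ?case ..
  qed
  have "((\<lambda>Y. integral\<^sup>L (count_space A) (h Y)) \<longlongrightarrow> integral\<^sup>L (count_space A) l) at_top"
  proof (rule integral_dominated_convergence_at_top [where w = w])
    show "integrable (count_space A) w"
      unfolding w_def [abs_def] A_def by (intro Bochner_Integration.integrable_mult_right int)
    show "\<forall>\<^sub>F Y in at_top. AE t in count_space A. norm (h Y t) \<le> w t"
      using bound by eventually_elim auto
  qed (auto simp: lim)
  moreover have "integral\<^sup>L (count_space A) (h Y) =
      of_real (1 / Y) * (LINT y:{y0..Y}|lebesgue. (\<Sum>j\<in>J Y. c j * exp (\<i> * of_real (\<mu> j * y))) ^ n)" for Y
  proof -
    have "integral\<^sup>L (count_space A) (h Y) = infsetsum (h Y) A"
      by (simp add: infsetsum_def)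
    also have "\<dots> = infsetsum (h Y) {t. set t \<subseteq> J Y \<and> length t = n}"
      by (rule infsetsum_cong_neutral) (auto simp: A_def h_def)
    also have "\<dots> = (\<Sum>t | set t \<subseteq> J Y \<and> length t = n. h Y t)"
      by (rule infsetsum_finite) (rule finite_lists_length_eq [OF J(1)])
    also have "\<dots> = (\<Sum>t | set t \<subseteq> J Y \<and> length t = n. prod_list (map c t) * exp_mean y0 (sum_list (map \<mu> t)) Y)"
      by (intro sum.cong) (auto simp: h_def)
    finally show ?thesis by (simp only: mean_power_exp_sum [OF J(1)])
  qed
  ultimately show ?thesis by auto
qed

section \<open>Signed frequencies of the associated data\<close>

lemma finite_le_of_filterlim_at_top:
  fixes lam :: "nat \<Rightarrow> real"
  assumes "filterlim lam at_top sequentially"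
  shows "finite {n. lam n \<le> X}"
proof -
  have "\<forall>\<^sub>F n in sequentially. X < lam n"
    using assms by (simp add: filterlim_at_top_dense)
  then obtain N where "\<And>n. N \<le> n \<Longrightarrow> X < lam n"
    by (auto simp: eventually_sequentially)
  then have "{n. lam n \<le> X} \<subseteq> {..<N}"
    by (auto simp: not_le [symmetric])
  then show ?thesis by (rule finite_subset) simp
qed

text \<open>The hypothesis speaks only of windows far out on the positive axis. Near the origin
  there are finitely many frequencies, whose total mass goes into the constant; negative frequencies
  are reflected.\<close>

lemma window_decay_signed:
  fixes lam :: "nat \<Rightarrow> real" and r :: "nat \<Rightarrow> complex"
  assumes pos: "\<And>n. 0 < lam n" and lam: "filterlim lam at_top sequentially" and "0 < \<beta>"
    and C: "0 < C" and r: "\<And>T. T0 \<le> T \<Longrightarrow> (\<Sum>n | T \<le> lam n \<and> lam n \<le> T + 1. cmod (r n)) \<le> C * T powr (- \<beta>)"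
  shows "window_decay (\<lambda>j. cmod (r (fst j))) (\<lambda>j. if snd j then lam (fst j) else - lam (fst j)) \<beta>"
proof -
  have fin: "finite {n. lam n \<le> X}" for X
    by (rule finite_le_of_filterlim_at_top [OF lam])
  \<comment> \<open>With \<open>T1\<close> at least 2, every \<open>T\<close> beyond it is at least
    \<open>(2 + T) / 2\<close>; this yields the factor \<open>2 powr \<beta>\<close> in
    \<open>D\<close>. The other summand of \<open>D\<close> serves the windows starting below
    \<open>T1\<close>.\<close>
  define T1 where "T1 = max T0 2"
  define R where "R = (\<Sum>n | lam n \<le> T1 + 1. cmod (r n))"
  define D where "D = C * 2 powr \<beta> + R * (2 + T1) powr \<beta>"
  have R: "0 \<le> R" by (simp add: R_def sum_nonneg)
  have D: "0 \<le> D" using C R by (simp add: D_def)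
  have bound: "(\<Sum>n | T \<le> lam n \<and> lam n \<le> T + 1. cmod (r n)) \<le> D * (2 + T) powr (- \<beta>)" if "0 \<le> T" for T
  proof (cases "T1 \<le> T")
    case True
    then have "(\<Sum>n | T \<le> lam n \<and> lam n \<le> T + 1. cmod (r n)) \<le> C * T powr (- \<beta>)"
      by (intro r) (simp add: T1_def)
    also have "\<dots> \<le> C * ((2 + T) / 2) powr (- \<beta>)"
      using True C \<open>0 < \<beta>\<close> by (intro mult_left_mono powr_mono2') (auto simp: T1_def)
    also have "\<dots> = C * 2 powr \<beta> * (2 + T) powr (- \<beta>)"
      using that by (simp add: powr_divide powr_minus field_simps)
    also have "\<dots> \<le> D * (2 + T) powr (- \<beta>)"
      using R by (intro mult_right_mono) (auto simp: D_def)
    finally show ?thesis .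
  next
    case False
    have "(\<Sum>n | T \<le> lam n \<and> lam n \<le> T + 1. cmod (r n)) \<le> R"
      unfolding R_def using False by (intro sum_mono2 fin) auto
    also have "\<dots> = R * (2 + T1) powr \<beta> * (2 + T1) powr (- \<beta>)"
      by (simp add: T1_def powr_add [symmetric] mult.assoc)
    also have "\<dots> \<le> R * (2 + T1) powr \<beta> * (2 + T) powr (- \<beta>)"
      using False that R \<open>0 < \<beta>\<close> by (intro mult_left_mono powr_mono2') auto
    also have "\<dots> \<le> D * (2 + T) powr (- \<beta>)"
      using C by (intro mult_right_mono) (auto simp: D_def)
    finally show ?thesis .
  qed
  have mass: "(\<Sum>j\<in>J. cmod (r (fst j))) \<le> D * (1 + \<bar>of_int m\<bar>) powr (-\<beta>)"
    if J: "finite J" "\<And>j. j \<in> J \<Longrightarrow> \<lfloor>if snd j then lam (fst j) else - lam (fst j)\<rfloor> = m" for m J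
  proof -
    \<comment> \<open>For negative \<open>m\<close>, a value \<open>-lam\<close> in
      \<open>[m, m+1)\<close> means \<open>lam\<close> in \<open>(-m-1, -m]\<close>, so the window
      starts at \<open>-m-1\<close>. Then |m| is \<open>T + 1\<close>, which is why
      \<open>bound\<close> is stated with \<open>2 + T\<close>.\<close>
    define T where "T = (if 0 \<le> m then real_of_int m else - of_int m - 1)"
    have "real_of_int m \<le> -1" if "m < 0" using that by linarith
    then have T: "0 \<le> T" "1 + \<bar>real_of_int m\<bar> \<le> 2 + T" by (auto simp: T_def)
    \<comment> \<open>As all \<open>lam\<close> are positive, the sign of \<open>m\<close> fixes the
      second component. Hence \<open>fst\<close> is injective on \<open>J\<close> and no
      \<open>cmod (r n)\<close> is counted twice.\<close>
    have sgn: "snd j = (0 \<le> m)" and win: "T \<le> lam (fst j)" "lam (fst j) \<le> T + 1" if "j \<in> J" for j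
    proof -
      have *: "of_int m \<le> (if snd j then lam (fst j) else - lam (fst j))"
        "(if snd j then lam (fst j) else - lam (fst j)) < of_int m + 1"
        using J(2) [OF that] by linarith+
      show s: "snd j = (0 \<le> m)"
      proof (cases "snd j")
        case True
        then have "0 < real_of_int m + 1" using * pos [of "fst j"] by simp
        then show ?thesis using True by linarith
      next
        case False
        then have "real_of_int m < 0" using * pos [of "fst j"] by simp
        then show ?thesis using False by linarith
      qed
      show "T \<le> lam (fst j)" "lam (fst j) \<le> T + 1"
        using * s by (auto simp: T_def split: if_splits)
    qed
    have inj: "inj_on fst J" using sgn by (auto simp: inj_on_def prod_eq_iff)
    have "(\<Sum>j\<in>J. cmod (r (fst j))) = (\<Sum>n\<in>fst ` J. cmod (r n))"
      by (simp add: sum.reindex [OF inj])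
    also have "\<dots> \<le> (\<Sum>n | T \<le> lam n \<and> lam n \<le> T + 1. cmod (r n))"
      using win by (intro sum_mono2 finite_subset [OF _ fin [of "T + 1"]]) auto
    also have "\<dots> \<le> D * (2 + T) powr (-\<beta>)" by (rule bound [OF T(1)])
    also have "\<dots> \<le> D * (1 + \<bar>of_int m\<bar>) powr (-\<beta>)"
      using T D \<open>0 < \<beta>\<close> by (intro mult_left_mono powr_mono2') auto
    finally show ?thesis .
  qed
  show ?thesis
    unfolding window_decay_def
    by (intro conjI allI exI [of _ D] impI mass) (use D in \<open>blast intro: norm_ge_zero\<close>)+
qed

text \<open>Twice a real part is a number plus its conjugate, so the real sum is an exponential sum
  over pairs of an index and a sign, with the coefficient conjugated for the negative sign.\<close>

lemma mean_power_real_exp_sum_convergent: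
  fixes lam :: "nat \<Rightarrow> real" and r :: "nat \<Rightarrow> complex" and p :: nat
  assumes pos: "\<And>n. 0 < lam n" and lam: "filterlim lam at_top sequentially"
    and C: "0 < C" and r: "\<And>T. T0 \<le> T \<Longrightarrow> (\<Sum>n | T \<le> lam n \<and> lam n \<le> T + 1. cmod (r n)) \<le> C * T powr (- \<beta>)"
    and p: "1 \<le> p" "\<beta> > 1 - 1 / real p" "n \<le> p" and y0: "0 < y0" and XY: "filterlim XY at_top at_top"
  shows "\<exists>L. ((\<lambda>Y. 1 / Y * (LINT y:{y0..Y}|lebesgue.
    (2 * Re (\<Sum>n | 0 < lam n \<and> lam n \<le> XY Y. r n * exp (\<i> * of_real (lam n * y)))) ^ n)) \<longlongrightarrow> L) at_top"
proof -
  define c where "c j = (if snd j then r (fst j) else cnj (r (fst j)))" for j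
  define \<mu> where "\<mu> j = (if snd j then lam (fst j) else - lam (fst j))" for j
  define A where "A Y = {n. 0 < lam n \<and> lam n \<le> XY Y}" for Y
  have cm: "cmod (c j) = cmod (r (fst j))" for j by (simp add: c_def)
  have "0 \<le> 1 - 1 / real p" using p(1) by simp
  then have "0 < \<beta>" using p(2) by linarith
  then have "window_decay (\<lambda>j. cmod (c j)) \<mu> \<beta>"
    unfolding cm \<mu>_def by (intro window_decay_signed [OF pos lam _ C r])
  note int = tuple_sum_integrable [OF this p]
  have A: "finite (A Y)" for Y
    unfolding A_def by (rule finite_subset [OF _ finite_le_of_filterlim_at_top [OF lam, of "XY Y"]]) auto
  then have fin: "finite (A Y \<times> (UNIV :: bool set))" for Y by simp
  have ev: "\<forall>\<^sub>F Y in at_top. j \<in> A Y \<times> UNIV" for j :: "nat \<times> bool"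
  proof -
    have "\<forall>\<^sub>F Y in at_top. lam (fst j) \<le> XY Y" using XY by (simp add: filterlim_at_top)
    then show ?thesis by eventually_elim (auto simp: A_def pos mem_Times_iff)
  qed
  obtain L where L: "((\<lambda>Y. of_real (1 / Y) *
    (LINT y:{y0..Y}|lebesgue. (\<Sum>j\<in>A Y \<times> UNIV. c j * exp (\<i> * of_real (\<mu> j * y))) ^ n)) \<longlongrightarrow> L) at_top"
    using mean_power_exp_sum_convergent [OF int, where J = "\<lambda>Y. A Y \<times> UNIV", OF fin ev y0] by blast
  have S: "(\<Sum>j\<in>A Y \<times> UNIV. c j * exp (\<i> * of_real (\<mu> j * y))) =
      of_real (2 * Re (\<Sum>n\<in>A Y. r n * exp (\<i> * of_real (lam n * y))))" for Y y
  proof -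
    have "(\<Sum>j\<in>A Y \<times> UNIV. c j * exp (\<i> * of_real (\<mu> j * y))) =
        (\<Sum>n\<in>A Y. \<Sum>b\<in>UNIV. c (n, b) * exp (\<i> * of_real (\<mu> (n, b) * y)))"
      by (simp add: sum.cartesian_product)
    also have "\<dots> = (\<Sum>n\<in>A Y. of_real (2 * Re (r n * exp (\<i> * of_real (lam n * y)))))"
    proof (intro sum.cong refl)
      fix n
      have "of_real (2 * Re (r n * exp (\<i> * of_real (lam n * y)))) =
          r n * exp (\<i> * of_real (lam n * y)) + cnj (r n * exp (\<i> * of_real (lam n * y)))"
        by (rule complex_add_cnj [symmetric])
      also have "cnj (r n * exp (\<i> * of_real (lam n * y))) = cnj (r n) * exp (\<i> * of_real (- lam n * y))"
        by (simp add: exp_cnj)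
      finally show "(\<Sum>b\<in>UNIV. c (n, b) * exp (\<i> * of_real (\<mu> (n, b) * y))) =
          of_real (2 * Re (r n * exp (\<i> * of_real (lam n * y))))"
        by (simp add: UNIV_bool c_def \<mu>_def add.commute)
    qed
    finally show ?thesis by (simp add: sum_distrib_left)
  qed
  have "of_real (1 / Y) * (LINT y:{y0..Y}|lebesgue. (\<Sum>j\<in>A Y \<times> UNIV. c j * exp (\<i> * of_real (\<mu> j * y))) ^ n) =
      complex_of_real (1 / Y * (LINT y:{y0..Y}|lebesgue. (2 * Re (\<Sum>n\<in>A Y. r n * exp (\<i> * of_real (lam n * y)))) ^ n))" for Y
    unfolding S unfolding of_real_power [symmetric] set_integral_complex_of_real unfolding of_real_mult ..
  \<comment> \<open>The means are real, so they converge to the real part of the complex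
    limit.\<close>
  from tendsto_Re [OF L [unfolded this]] show ?thesis
    unfolding Re_complex_of_real A_def by blast
qed

section \<open>Pointwise comparison of powers of a sum and of its main term\<close>

lemma abs_power_add_diff_le:
  fixes a b :: real
  shows "\<bar>(a + b) ^ n - a ^ n\<bar> \<le> real n * \<bar>b\<bar> * (\<bar>a\<bar> + \<bar>b\<bar>) ^ (n - 1)"
proof (induction n)
  case (Suc n)
  have "\<bar>(a + b) ^ Suc n - a ^ Suc n\<bar> = \<bar>(a + b) * ((a + b) ^ n - a ^ n) + b * a ^ n\<bar>"
    by (simp add: algebra_simps)
  also have "\<dots> \<le> \<bar>a + b\<bar> * \<bar>(a + b) ^ n - a ^ n\<bar> + \<bar>b\<bar> * \<bar>a\<bar> ^ n"
    by (rule order_trans [OF abs_triangle_ineq]) (simp add: abs_mult power_abs)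
  also have "\<dots> \<le> (\<bar>a\<bar> + \<bar>b\<bar>) * (real n * \<bar>b\<bar> * (\<bar>a\<bar> + \<bar>b\<bar>) ^ (n - 1)) + \<bar>b\<bar> * (\<bar>a\<bar> + \<bar>b\<bar>) ^ n"
    by (intro add_mono mult_mono Suc power_mono mult_left_mono) auto
  also have "\<dots> = real (Suc n) * \<bar>b\<bar> * (\<bar>a\<bar> + \<bar>b\<bar>) ^ (Suc n - 1)"
    by (cases n) (simp_all add: algebra_simps)
  finally show ?case .
qed simp

text \<open>Convergence is known only for means of powers without absolute values. An even exponent
  makes such a mean control the size of the sum.\<close>

lemma max_one_power_le:
  fixes a :: real
  assumes "even q"
  shows "max 1 \<bar>a\<bar> ^ q \<le> 1 + a ^ q"
proof (cases "\<bar>a\<bar> \<le> 1")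
  case True
  then show ?thesis using assms by (simp add: max_def zero_le_even_power)
next
  case False
  then show ?thesis using assms by (simp add: max_def power_even_abs)
qed

text \<open>Either \<open>b\<close> is small relative to \<open>max 1 |a|\<close>, and the
  difference is a small multiple of its \<open>p\<close>-th power; or \<open>b\<close> dominates,
  and everything is absorbed into |b|^p. The second constant blows up as \<delta> tends to 0, which
  is harmless because \<delta> is fixed before \<open>Y\<close> grows.\<close>

lemma abs_power_add_diff_le_even:
  fixes a b \<delta> :: real
  assumes n: "1 \<le> n" "n \<le> p" "even p" and d: "0 < \<delta>" "\<delta> \<le> 1"
  shows "\<bar>(a + b) ^ n - a ^ n\<bar> \<le> real p * 2 ^ p * \<delta> * (1 + a ^ p) + real p * (1 / \<delta> + 1) ^ p * \<bar>b\<bar> ^ p"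
proof (cases "\<bar>b\<bar> \<le> \<delta> * max 1 \<bar>a\<bar>")
  case True
  let ?m = "max 1 \<bar>a\<bar>"
  have "\<delta> * ?m \<le> 1 * ?m" using d by (intro mult_right_mono) auto
  then have ab: "\<bar>a\<bar> + \<bar>b\<bar> \<le> 2 * ?m" using True max.cobounded2 [of "\<bar>a\<bar>" 1] by linarith
  have "\<bar>(a + b) ^ n - a ^ n\<bar> \<le> real n * \<bar>b\<bar> * (\<bar>a\<bar> + \<bar>b\<bar>) ^ (n - 1)" by (rule abs_power_add_diff_le)
  also have "\<dots> \<le> real p * (\<delta> * ?m) * (2 * ?m) ^ (n - 1)"
    using n True ab by (intro mult_mono power_mono) auto
  also have "\<dots> \<le> real p * (\<delta> * ?m) * (2 * ?m) ^ (p - 1)"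
    using n d by (intro mult_left_mono power_increasing) auto
  also have "\<dots> \<le> real p * (\<delta> * (2 * ?m)) * (2 * ?m) ^ (p - 1)"
    using d by (intro mult_right_mono mult_left_mono) auto
  also have "\<dots> = real p * 2 ^ p * \<delta> * ?m ^ p"
    using n by (cases p) (auto simp: power_mult_distrib)
  also have "\<dots> \<le> real p * 2 ^ p * \<delta> * (1 + a ^ p)"
    using d n by (intro mult_left_mono max_one_power_le) auto
  also have "\<dots> \<le> \<dots> + real p * (1 / \<delta> + 1) ^ p * \<bar>b\<bar> ^ p" using d by simp
  finally show ?thesis .
next
  case False
  \<comment> \<open>In this case |a| < |b|/\<delta>, so |a| + |b| is at most \<kappa>|b|. Also 1 is
    at most \<kappa>|b|, which allows the exponent \<open>n - 1\<close> to be raised to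
    \<open>p - 1\<close>.\<close>
  define \<kappa> where "\<kappa> = 1 / \<delta> + 1"
  have \<kappa>: "1 \<le> \<kappa>" using d by (simp add: \<kappa>_def)
  have "max 1 \<bar>a\<bar> * \<delta> < \<bar>b\<bar>" using False by (simp only: not_le mult.commute)
  then have "max 1 \<bar>a\<bar> < \<bar>b\<bar> / \<delta>" by (simp only: pos_less_divide_eq [OF d(1)])
  then have *: "\<bar>a\<bar> + \<bar>b\<bar> \<le> \<kappa> * \<bar>b\<bar>" "1 \<le> \<kappa> * \<bar>b\<bar>" by (auto simp: \<kappa>_def distrib_right)
  have "\<bar>(a + b) ^ n - a ^ n\<bar> \<le> real n * \<bar>b\<bar> * (\<bar>a\<bar> + \<bar>b\<bar>) ^ (n - 1)" by (rule abs_power_add_diff_le)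
  also have "\<dots> \<le> real p * (\<kappa> * \<bar>b\<bar>) * (\<kappa> * \<bar>b\<bar>) ^ (n - 1)"
    using n * \<kappa> by (intro mult_mono power_mono) (auto simp: mult_le_cancel_right1)
  also have "\<dots> \<le> real p * (\<kappa> * \<bar>b\<bar>) * (\<kappa> * \<bar>b\<bar>) ^ (p - 1)"
    using n * \<kappa> by (intro mult_left_mono power_increasing) auto
  also have "\<dots> = real p * \<kappa> ^ p * \<bar>b\<bar> ^ p"
    using n by (cases p) (auto simp: power_mult_distrib)
  also have "\<dots> \<le> real p * 2 ^ p * \<delta> * (1 + a ^ p) + \<dots>"
    using d n by (simp add: zero_le_even_power)
  finally show ?thesis by (simp add: \<kappa>_def)
qed

text \<open>For odd \<open>p = Suc q\<close> the factor |b| is bounded outright by \<delta>, so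
  \<open>a\<close> enters only with exponent \<open>n - 1\<close>, at most the even number
  \<open>q\<close>. This is where uniform smallness of the error replaces a mean of |a|^p.\<close>

lemma abs_power_add_diff_le_small:
  fixes a b \<delta> :: real
  assumes n: "n \<le> Suc q" "even q" and d: "\<bar>b\<bar> \<le> \<delta>" "\<delta> \<le> 1"
  shows "\<bar>(a + b) ^ n - a ^ n\<bar> \<le> real (Suc q) * 2 ^ q * \<delta> * (1 + a ^ q)"
proof -
  let ?m = "max 1 \<bar>a\<bar>"
  have "\<bar>(a + b) ^ n - a ^ n\<bar> \<le> real n * \<bar>b\<bar> * (\<bar>a\<bar> + \<bar>b\<bar>) ^ (n - 1)" by (rule abs_power_add_diff_le)
  also have "\<dots> \<le> real (Suc q) * \<delta> * (2 * ?m) ^ (n - 1)"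
    using n d by (intro mult_mono power_mono) auto
  also have "\<dots> \<le> real (Suc q) * \<delta> * (2 * ?m) ^ q"
    using n d by (intro mult_left_mono power_increasing) auto
  also have "\<dots> = real (Suc q) * 2 ^ q * \<delta> * ?m ^ q"
    by (simp add: power_mult_distrib)
  also have "\<dots> \<le> real (Suc q) * 2 ^ q * \<delta> * (1 + a ^ q)"
    using d n by (intro mult_left_mono max_one_power_le) auto
  finally show ?thesis .
qed

section \<open>Integrability and passage from the sums to the function\<close>

lemma set_integrable_power_of_le:
  fixes f :: "real \<Rightarrow> real"
  assumes "f \<in> borel_measurable (lebesgue_on {0..})" and "0 \<le> a"
    and int: "set_integrable lebesgue {a..b} (\<lambda>y. \<bar>f y\<bar> ^ p)" and "n \<le> p"
  shows "set_integrable lebesgue {a..b} (\<lambda>y. f y ^ n)"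
proof (rule set_integrable_bound)
  show "set_integrable lebesgue {a..b} (\<lambda>y. 1 + \<bar>f y\<bar> ^ p)"
    by (intro set_integral_add int absolutely_integrable_continuous_real continuous_intros)
  have "(\<lambda>y. f y ^ n) \<in> borel_measurable (lebesgue_on {0..})"
    using assms(1) by measurable
  \<comment> \<open>Measurability is given only on the half-line; it becomes measurability of the
    function cut off there and is then restricted to \<open>{a..b}\<close>.\<close>
  then have "set_borel_measurable lebesgue {0..} (\<lambda>y. f y ^ n)"
    unfolding set_borel_measurable_def by (subst (asm) borel_measurable_restrict_space_iff) auto
  then show "set_borel_measurable lebesgue {a..b} (\<lambda>y. f y ^ n)"
    by (rule set_borel_measurable_subset) (use \<open>0 \<le> a\<close> in auto)
  have "\<bar>x\<bar> ^ n \<le> 1 + \<bar>x\<bar> ^ p" for x :: real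
  proof (cases "\<bar>x\<bar> \<le> 1")
    case True
    then have "\<bar>x\<bar> ^ n \<le> 1" by (simp add: power_le_one)
    then show ?thesis by (simp add: add_increasing2)
  next
    case False
    then have "\<bar>x\<bar> ^ n \<le> \<bar>x\<bar> ^ p" using \<open>n \<le> p\<close> by (intro power_increasing) auto
    then show ?thesis by simp
  qed
  then show "AE y in lebesgue. y \<in> {a..b} \<longrightarrow> norm (f y ^ n) \<le> norm (1 + \<bar>f y\<bar> ^ p)"
    by (auto simp: power_abs)
qed

lemma abs_add_power_le:
  fixes a b :: real
  shows "\<bar>a + b\<bar> ^ p \<le> 2 ^ p * (\<bar>a\<bar> ^ p + \<bar>b\<bar> ^ p)"
proof -
  have "\<bar>a + b\<bar> ^ p \<le> (2 * max \<bar>a\<bar> \<bar>b\<bar>) ^ p" by (intro power_mono) auto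
  also have "\<dots> = 2 ^ p * max \<bar>a\<bar> \<bar>b\<bar> ^ p" by (rule power_mult_distrib)
  also have "max \<bar>a\<bar> \<bar>b\<bar> ^ p \<le> \<bar>a\<bar> ^ p + \<bar>b\<bar> ^ p" by (auto simp: max_def)
  finally show ?thesis by simp
qed

text \<open>Since \<open>K\<close> may depend on \<delta>, the order matters: \<delta> is chosen
  from the limit of the \<open>q\<close>-th means, and then the fixed multiple \<open>K\<close> of
  the error mean is made small by taking \<open>Y\<close> large.\<close>

lemma mean_power_tendsto_of_approx:
  fixes \<phi> :: "real \<Rightarrow> real" and S E :: "real \<Rightarrow> real \<Rightarrow> real"
  assumes y0: "0 < y0"
    and int: "\<And>Y. 0 \<le> Y \<Longrightarrow> set_integrable lebesgue {0..Y} (\<lambda>y. \<phi> y ^ n)"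
    and cont: "\<And>Y. continuous_on UNIV (S Y)"
    and Sn: "((\<lambda>Y. 1 / Y * (LINT y:{y0..Y}|lebesgue. S Y y ^ n)) \<longlongrightarrow> L) at_top"
    and Sq: "((\<lambda>Y. 1 / Y * (LINT y:{y0..Y}|lebesgue. S Y y ^ q)) \<longlongrightarrow> Lq) at_top"
    and Eint: "\<forall>\<^sub>F Y in at_top. set_integrable lebesgue {y0..Y} (\<lambda>y. \<bar>E Y y\<bar> ^ p)"
    and Elim: "((\<lambda>Y. 1 / Y * (LINT y:{y0..Y}|lebesgue. \<bar>E Y y\<bar> ^ p)) \<longlongrightarrow> 0) at_top"
    and approx: "\<And>\<delta>. 0 < \<delta> \<Longrightarrow> \<exists>K. \<forall>\<^sub>F Y in at_top. \<forall>y\<in>{y0..Y}.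
      \<bar>\<phi> y ^ n - S Y y ^ n\<bar> \<le> \<delta> * (1 + S Y y ^ q) + K * \<bar>E Y y\<bar> ^ p"
  shows "((\<lambda>Y. 1 / Y * (LINT y:{0..Y}|lebesgue. \<phi> y ^ n)) \<longlongrightarrow> L) at_top"
proof -
  have Sint: "set_integrable lebesgue {y0..Y} (\<lambda>y. S Y y ^ k)" for Y k
    by (intro absolutely_integrable_continuous_real continuous_intros continuous_on_subset [OF cont]) auto
  have one: "set_integrable lebesgue {y0..Y} (\<lambda>y. 1 :: real)" for Y
    by (intro absolutely_integrable_continuous_real continuous_intros)
  have \<phi>int: "set_integrable lebesgue {y0..Y} (\<lambda>y. \<phi> y ^ n)" if "y0 \<le> Y" for Y
    by (rule set_integrable_subset [OF int [of Y]]) (use that y0 in auto)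
  have diff: "((\<lambda>Y. 1 / Y * (LINT y:{y0..Y}|lebesgue. \<phi> y ^ n - S Y y ^ n)) \<longlongrightarrow> 0) at_top"
  proof (rule tendstoI)
    fix e :: real assume e: "0 < e"
    \<comment> \<open>Of the 2, one unit bounds \<open>(Y - y0) / Y\<close>; the other, with |Lq|,
      bounds the mean of \<open>S Y y ^ q\<close> for large \<open>Y\<close>. The first term thus
      contributes at most \<open>\<delta> * B = e / 2\<close>.\<close>
    define B where "B = \<bar>Lq\<bar> + 2"
    have B: "0 < B" by (simp add: B_def add_nonneg_pos)
    define \<delta> where "\<delta> = e / (2 * B)"
    have \<delta>: "0 < \<delta>" using e B by (simp add: \<delta>_def)
    from approx [OF \<delta>] obtain K where K: "\<forall>\<^sub>F Y in at_top. \<forall>y\<in>{y0..Y}.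
      \<bar>\<phi> y ^ n - S Y y ^ n\<bar> \<le> \<delta> * (1 + S Y y ^ q) + K * \<bar>E Y y\<bar> ^ p" by blast
    have "((\<lambda>Y. K * (1 / Y * (LINT y:{y0..Y}|lebesgue. \<bar>E Y y\<bar> ^ p))) \<longlongrightarrow> K * 0) at_top"
      by (intro tendsto_intros Elim)
    then have KE: "\<forall>\<^sub>F Y in at_top. K * (1 / Y * (LINT y:{y0..Y}|lebesgue. \<bar>E Y y\<bar> ^ p)) < e / 2"
      using e by (intro order_tendstoD) auto
    have "\<forall>\<^sub>F Y in at_top. 1 / Y * (LINT y:{y0..Y}|lebesgue. S Y y ^ q) < \<bar>Lq\<bar> + 1"
      by (intro order_tendstoD [OF Sq]) auto
    with K KE Eint eventually_ge_at_top [of y0]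
    show "\<forall>\<^sub>F Y in at_top. dist (1 / Y * (LINT y:{y0..Y}|lebesgue. \<phi> y ^ n - S Y y ^ n)) 0 < e"
    proof eventually_elim
      case (elim Y)
      have Y: "0 < Y" using elim y0 by simp
      have "\<bar>LINT y:{y0..Y}|lebesgue. \<phi> y ^ n - S Y y ^ n\<bar> \<le>
          (LINT y:{y0..Y}|lebesgue. \<bar>\<phi> y ^ n - S Y y ^ n\<bar>)"
        using set_integral_norm_bound [of lebesgue "{y0..Y}" "\<lambda>y. \<phi> y ^ n - S Y y ^ n"]
          \<phi>int elim Sint by auto
      also have "\<dots> \<le> (LINT y:{y0..Y}|lebesgue. \<delta> * (1 + S Y y ^ q) + K * \<bar>E Y y\<bar> ^ p)"
        using elim \<phi>int Sint one
        by (intro set_integral_mono set_integrable_abs set_integral_diff set_integral_add set_integrable_mult_right) auto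
      also have "\<dots> = \<delta> * ((LINT y:{y0..Y}|lebesgue. 1) + (LINT y:{y0..Y}|lebesgue. S Y y ^ q))
          + K * (LINT y:{y0..Y}|lebesgue. \<bar>E Y y\<bar> ^ p)"
        using elim Sint one by (simp add: set_integral_add)
      also have "(LINT y:{y0..Y}|lebesgue. 1) = Y - y0"
        using elim by (simp add: set_lebesgue_integral_def)
      finally have "1 / Y * \<bar>LINT y:{y0..Y}|lebesgue. \<phi> y ^ n - S Y y ^ n\<bar> \<le>
         1 / Y * (\<delta> * (Y - y0 + (LINT y:{y0..Y}|lebesgue. S Y y ^ q))
          + K * (LINT y:{y0..Y}|lebesgue. \<bar>E Y y\<bar> ^ p))"
        using Y by (intro mult_left_mono) auto
      also have "\<dots> = \<delta> * ((Y - y0) / Y + 1 / Y * (LINT y:{y0..Y}|lebesgue. S Y y ^ q))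
          + K * (1 / Y * (LINT y:{y0..Y}|lebesgue. \<bar>E Y y\<bar> ^ p))"
        using Y by (simp add: field_simps)
      also have "\<dots> < \<delta> * (1 + (\<bar>Lq\<bar> + 1)) + e / 2"
        using elim \<delta> Y y0 by (intro add_strict_mono mult_strict_left_mono add_le_less_mono) auto
      also have "\<dots> = e" using B by (simp add: \<delta>_def B_def field_simps)
      finally show ?case using Y by (simp add: dist_real_def abs_mult)
    qed
  qed
  \<comment> \<open>The initial segment has a fixed integral, hence vanishing mean.\<close>
  have "((\<lambda>Y. 1 / Y * (LINT y:{0..y0}|lebesgue. \<phi> y ^ n)) \<longlongrightarrow> 0) at_top"
    by (rule tendsto_mult_left_zero) real_asymp
  from tendsto_add [OF this tendsto_add [OF Sn diff]]
  have "((\<lambda>Y. 1 / Y * (LINT y:{0..y0}|lebesgue. \<phi> y ^ n) + (1 / Y * (LINT y:{y0..Y}|lebesgue. S Y y ^ n) +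
      1 / Y * (LINT y:{y0..Y}|lebesgue. \<phi> y ^ n - S Y y ^ n))) \<longlongrightarrow> L) at_top" by simp
  then show ?thesis
  proof (rule Lim_transform_eventually)
    show "\<forall>\<^sub>F Y in at_top. 1 / Y * (LINT y:{0..y0}|lebesgue. \<phi> y ^ n) + (1 / Y * (LINT y:{y0..Y}|lebesgue. S Y y ^ n) +
      1 / Y * (LINT y:{y0..Y}|lebesgue. \<phi> y ^ n - S Y y ^ n)) = 1 / Y * (LINT y:{0..Y}|lebesgue. \<phi> y ^ n)"
      using eventually_ge_at_top [of y0]
    proof eventually_elim
      case (elim Y)
      have "{0..Y} = {0..y0} \<union> {y0..Y}" using elim y0 by auto
      then have "(LINT y:{0..Y}|lebesgue. \<phi> y ^ n) = (LINT y:{0..y0} \<union> {y0..Y}|lebesgue. \<phi> y ^ n)" by simp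
      also have "\<dots> = (LINT y:{0..y0}|lebesgue. \<phi> y ^ n) + (LINT y:{y0..Y}|lebesgue. \<phi> y ^ n)"
      proof (rule set_integral_Un_AE)
        have "AE y in lebesgue. y \<noteq> y0"
          by (rule AE_completion) (rule AE_lborel_singleton)
        then show "AE y in lebesgue. \<not> (y \<in> {0..y0} \<and> y \<in> {y0..Y})" by eventually_elim auto
      qed (use int y0 \<phi>int elim in auto)
      also have "(LINT y:{y0..Y}|lebesgue. \<phi> y ^ n) =
          (LINT y:{y0..Y}|lebesgue. S Y y ^ n) + (LINT y:{y0..Y}|lebesgue. \<phi> y ^ n - S Y y ^ n)"
        using Sint \<phi>int [OF elim] by (simp add: set_integral_diff)
      finally show ?case by (simp add: distrib_left add_divide_distrib)
    qed
  qed
qed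

lemma eventually_uniformly_small:
  fixes f :: "real \<Rightarrow> real \<Rightarrow> real"
  assumes "Limsup at_top (\<lambda>Y. SUP y\<in>{a..Y}. ereal \<bar>f Y y\<bar>) = 0" "0 < \<epsilon>"
  shows "\<forall>\<^sub>F Y in at_top. \<forall>y\<in>{a..Y}. \<bar>f Y y\<bar> \<le> \<epsilon>"
proof -
  have "\<forall>\<^sub>F Y in at_top. (SUP y\<in>{a..Y}. ereal \<bar>f Y y\<bar>) < ereal \<epsilon>"
    using assms by (intro Limsup_lessD) auto
  then show ?thesis
  proof eventually_elim
    case (elim Y)
    show ?case
    proof
      fix y assume "y \<in> {a..Y}"
      then have "ereal \<bar>f Y y\<bar> \<le> (SUP y\<in>{a..Y}. ereal \<bar>f Y y\<bar>)" by (rule SUP_upper)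
      then have "ereal \<bar>f Y y\<bar> < ereal \<epsilon>" using elim by (rule order_le_less_trans)
      then show "\<bar>f Y y\<bar> \<le> \<epsilon>" by simp
    qed
  qed
qed

section \<open>Moments of the given function\<close>

theorem theorem1p3:
  fixes p :: nat and \<beta> :: real and \<phi> :: "real \<Rightarrow> real"
    and lam :: "nat \<Rightarrow> real" and r :: "nat \<Rightarrow> complex" and y0 X0 :: real
    and \<E> :: "real \<Rightarrow> real \<Rightarrow> real" and XY :: "real \<Rightarrow> real"
  assumes "1 \<le> p"
    and "\<beta> > 1 - 1 / real p"
    and "p_beta_function_data (real p) \<beta> \<phi> lam r y0 X0 \<E> XY"
    and "odd p \<Longrightarrow> p > 1 \<Longrightarrow>
           Limsup at_top (\<lambda>Y. SUP y\<in>{y0..Y}. ereal \<bar>\<E> y (XY Y)\<bar>) = 0"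
  shows "\<forall>n\<in>{1..p}.
           (\<forall>Y\<ge>0. set_integrable lebesgue {0..Y} (\<lambda>y. \<phi> y ^ n)) \<and>
           (\<exists>L::real. ((\<lambda>Y. 1 / Y * (LINT y:{0..Y}|lebesgue. \<phi> y ^ n)) \<longlongrightarrow> L) at_top)"
proof -
  define S where "S Y y = 2 * Re (\<Sum>n | 0 < lam n \<and> lam n \<le> XY Y. r n * exp (\<i> * of_real (lam n * y)))" for Y y
  define E where "E Y y = \<E> y (XY Y)" for Y y
  \<comment> \<open>At \<open>x = 0\<close> the two powers agree only for positive \<open>p\<close>,
    since \<open>0 powr 0\<close> is 0 while \<open>0 ^ 0\<close> is 1.\<close>
  have pw: "\<bar>x\<bar> powr real p = \<bar>x\<bar> ^ p" for x :: real
    using assms(1) by (intro powr_realpow') auto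
  note data = assms(3) [unfolded p_beta_function_data_def p_function_data_def pw, folded E_def]
  have meas: "\<phi> \<in> borel_measurable (lebesgue_on {0..})"
    and pos: "\<And>n. 0 < lam n" and lam: "filterlim lam at_top sequentially" and y0: "0 < y0"
    and \<phi>0: "set_integrable lebesgue {0..y0} (\<lambda>y. \<bar>\<phi> y\<bar> ^ p)"
    and \<phi>: "\<And>y X. y0 \<le> y \<Longrightarrow> X0 \<le> X \<Longrightarrow>
      \<phi> y = 2 * Re (\<Sum>n | 0 < lam n \<and> lam n \<le> X. r n * exp (\<i> * of_real (lam n * y))) + \<E> y X"
    and XY: "filterlim XY at_top at_top"
    and Eint: "\<forall>\<^sub>F Y in at_top. set_integrable lebesgue {y0..Y} (\<lambda>y. \<bar>E Y y\<bar> ^ p)"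
    and Elim: "((\<lambda>Y. 1 / Y * (LINT y:{y0..Y}|lebesgue. \<bar>E Y y\<bar> ^ p)) \<longlongrightarrow> 0) at_top"
    using data by blast+
  obtain C T0 where C: "0 < C" "\<And>T. T0 \<le> T \<Longrightarrow> (\<Sum>n | T \<le> lam n \<and> lam n \<le> T + 1. cmod (r n)) \<le> C * T powr (- \<beta>)"
    using data by blast
  have SE: "\<forall>\<^sub>F Y in at_top. \<forall>y\<ge>y0. \<phi> y = S Y y + E Y y"
  proof -
    have "\<forall>\<^sub>F Y in at_top. X0 \<le> XY Y" using XY by (simp add: filterlim_at_top)
    then show ?thesis by eventually_elim (auto simp: S_def E_def \<phi>)
  qed
  have cont: "continuous_on A (S Y)" for A Y
    unfolding S_def by (intro continuous_intros)
  \<comment> \<open>The decomposition and the integrability of the error hold only for large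
    truncation parameters. One such \<open>Z\<close> beyond both \<open>Y\<close> and
    \<open>y0\<close> is fixed, and its sum and error dominate \<phi> on all of
    \<open>{y0..Z}\<close>.\<close>
  have \<phi>int: "set_integrable lebesgue {0..Y} (\<lambda>y. \<bar>\<phi> y\<bar> ^ p)" for Y
  proof -
    obtain Z where Z: "Y \<le> Z" "y0 \<le> Z" "\<And>y. y0 \<le> y \<Longrightarrow> \<phi> y = S Z y + E Z y"
      "set_integrable lebesgue {y0..Z} (\<lambda>y. \<bar>E Z y\<bar> ^ p)"
      using eventually_happens' [OF _ eventually_conj [OF SE eventually_conj [OF Eint eventually_ge_at_top [of "max Y y0"]]]]
      by auto
    have "set_integrable lebesgue {y0..Z} (\<lambda>y. \<bar>\<phi> y\<bar> ^ p)"
    proof (rule set_integrable_bound)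
      show "set_integrable lebesgue {y0..Z} (\<lambda>y. 2 ^ p * (\<bar>S Z y\<bar> ^ p + \<bar>E Z y\<bar> ^ p))"
        by (intro set_integrable_mult_right set_integral_add Z absolutely_integrable_continuous_real
            continuous_intros cont)
      have "(\<lambda>y. \<bar>\<phi> y\<bar> ^ p) \<in> borel_measurable (lebesgue_on {0..})"
        using meas by measurable
      then have "set_borel_measurable lebesgue {0..} (\<lambda>y. \<bar>\<phi> y\<bar> ^ p)"
        unfolding set_borel_measurable_def by (subst (asm) borel_measurable_restrict_space_iff) auto
      then show "set_borel_measurable lebesgue {y0..Z} (\<lambda>y. \<bar>\<phi> y\<bar> ^ p)"
        by (rule set_borel_measurable_subset) (use y0 in auto)
      show "AE y in lebesgue. y \<in> {y0..Z} \<longrightarrow> norm (\<bar>\<phi> y\<bar> ^ p) \<le> norm (2 ^ p * (\<bar>S Z y\<bar> ^ p + \<bar>E Z y\<bar> ^ p))"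
        using Z(3) abs_add_power_le by auto
    qed
    then have "set_integrable lebesgue ({0..y0} \<union> {y0..Z}) (\<lambda>y. \<bar>\<phi> y\<bar> ^ p)"
      by (intro set_integrable_Un \<phi>0) auto
    then show ?thesis
      by (rule set_integrable_subset) (use Z in auto)
  qed
  define q where "q = 2 * (p div 2)"
  have q: "even q" "q \<le> p" by (auto simp: q_def)
  have mean: "\<exists>L. ((\<lambda>Y. 1 / Y * (LINT y:{y0..Y}|lebesgue. S Y y ^ k)) \<longlongrightarrow> L) at_top" if "k \<le> p" for k
    unfolding S_def by (rule mean_power_real_exp_sum_convergent [OF pos lam C assms(1,2) that y0 XY])
  have approx: "\<exists>K. \<forall>\<^sub>F Y in at_top. \<forall>y\<in>{y0..Y}.
      \<bar>\<phi> y ^ n - S Y y ^ n\<bar> \<le> \<delta> * (1 + S Y y ^ q) + K * \<bar>E Y y\<bar> ^ p" if "0 < \<delta>" "1 \<le> n" "n \<le> p" for \<delta> n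
  proof -
    \<comment> \<open>Chosen to absorb the factor \<open>real p * 2 ^ p\<close> of the pointwise
      inequalities, which also require a value of at most 1.\<close>
    define \<epsilon> where "\<epsilon> = min 1 (\<delta> / (real p * 2 ^ p))"
    have \<epsilon>: "0 < \<epsilon>" "\<epsilon> \<le> 1" using that assms(1) by (auto simp: \<epsilon>_def)
    have "\<epsilon> \<le> \<delta> / (real p * 2 ^ p)" by (simp add: \<epsilon>_def)
    then have p\<epsilon>: "real p * 2 ^ p * \<epsilon> \<le> \<delta>" using assms(1) by (simp add: field_simps)
    have nonneg: "0 \<le> 1 + x ^ q" for x :: real using q by (simp add: zero_le_even_power add_nonneg_nonneg)
    have scale: "real p * 2 ^ p * \<epsilon> * (1 + x ^ q) \<le> \<delta> * (1 + x ^ q)" for x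
      using p\<epsilon> nonneg by (rule mult_right_mono)
    consider "even p" | "odd p" "p > 1" | "p = 1" using assms(1) by fastforce
    then show ?thesis
    proof cases
      case 1
      then have "q = p" by (simp add: q_def)
      have "\<forall>\<^sub>F Y in at_top. \<forall>y\<in>{y0..Y}. \<bar>\<phi> y ^ n - S Y y ^ n\<bar> \<le>
          \<delta> * (1 + S Y y ^ q) + real p * (1 / \<epsilon> + 1) ^ p * \<bar>E Y y\<bar> ^ p"
        using SE
      proof eventually_elim
        case (elim Y)
        have "\<bar>(S Y y + E Y y) ^ n - S Y y ^ n\<bar> \<le>
            \<delta> * (1 + S Y y ^ q) + real p * (1 / \<epsilon> + 1) ^ p * \<bar>E Y y\<bar> ^ p" for y
          using abs_power_add_diff_le_even [OF that(2,3) 1 \<epsilon>, of "S Y y" "E Y y"] scale [of "S Y y"] \<open>q = p\<close>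
          by simp
        with elim show ?case by simp
      qed
      then show ?thesis ..
    next
      case 2
      then have p: "p = Suc q" by (auto simp: q_def elim!: oddE)
      have "\<forall>\<^sub>F Y in at_top. \<forall>y\<in>{y0..Y}. \<bar>E Y y\<bar> \<le> \<epsilon>"
        using assms(4) [OF 2] \<epsilon> unfolding E_def by (intro eventually_uniformly_small)
      with SE have "\<forall>\<^sub>F Y in at_top. \<forall>y\<in>{y0..Y}. \<bar>\<phi> y ^ n - S Y y ^ n\<bar> \<le>
          \<delta> * (1 + S Y y ^ q) + 0 * \<bar>E Y y\<bar> ^ p"
      proof eventually_elim
        case (elim Y)
        show ?case
        proof
          fix y assume y: "y \<in> {y0..Y}"
          then have "\<bar>\<phi> y ^ n - S Y y ^ n\<bar> \<le> real (Suc q) * 2 ^ q * \<epsilon> * (1 + S Y y ^ q)"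
            using elim abs_power_add_diff_le_small [of n q "E Y y" \<epsilon> "S Y y"] that(3) p q \<epsilon> by auto
          also have "\<dots> \<le> real p * 2 ^ p * \<epsilon> * (1 + S Y y ^ q)"
            using nonneg \<epsilon> p by (intro mult_right_mono mult_left_mono power_increasing) auto
          finally show "\<bar>\<phi> y ^ n - S Y y ^ n\<bar> \<le> \<delta> * (1 + S Y y ^ q) + 0 * \<bar>E Y y\<bar> ^ p"
            using scale [of "S Y y"] by simp
        qed
      qed
      then show ?thesis ..
    next
      \<comment> \<open>Here no uniform smallness is available, but the difference is exactly the
        error term, so \<open>K = 1\<close> works.\<close>
      case 3
      then have "n = 1" using that by simp
      have "\<forall>\<^sub>F Y in at_top. \<forall>y\<in>{y0..Y}. \<bar>\<phi> y ^ n - S Y y ^ n\<bar> \<le>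
          \<delta> * (1 + S Y y ^ q) + 1 * \<bar>E Y y\<bar> ^ p"
        using SE by eventually_elim (use 3 \<open>n = 1\<close> that nonneg in auto)
      then show ?thesis ..
    qed
  qed
  have int: "set_integrable lebesgue {0..Y} (\<lambda>y. \<phi> y ^ n)" if "n \<le> p" for n Y
    by (rule set_integrable_power_of_le [OF meas _ \<phi>int that]) simp
  show ?thesis
  proof (intro ballI conjI allI impI)
    fix n Y assume "n \<in> {1..p}"
    then show "set_integrable lebesgue {0..Y} (\<lambda>y. \<phi> y ^ n)" by (intro int) simp
  next
    fix n assume n: "n \<in> {1..p}"
    then obtain L where L: "((\<lambda>Y. 1 / Y * (LINT y:{y0..Y}|lebesgue. S Y y ^ n)) \<longlongrightarrow> L) at_top"
      using mean [of n] by auto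
    obtain Lq where Lq: "((\<lambda>Y. 1 / Y * (LINT y:{y0..Y}|lebesgue. S Y y ^ q)) \<longlongrightarrow> Lq) at_top"
      using mean [of q] q by auto
    have "((\<lambda>Y. 1 / Y * (LINT y:{0..Y}|lebesgue. \<phi> y ^ n)) \<longlongrightarrow> L) at_top"
      using n by (intro mean_power_tendsto_of_approx [OF y0 int cont L Lq Eint Elim approx]) auto
    then show "\<exists>L. ((\<lambda>Y. 1 / Y * (LINT y:{0..Y}|lebesgue. \<phi> y ^ n)) \<longlongrightarrow> L) at_top" ..
  qed
qed

end
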